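(* Let $X$ be the complexification of a real Banach space and let $T$ be a real bounded linear operator on $X$ with a real square root, i.e., there is a real bounded linear operator $S$ on $X$ with $S^2=T$. Let $d\in\mathbb{N}$ and $\lambda<0$. If $T$ (respectively, the adjoint $T'$) has a Jordan block of dimension $d$ to $\lambda$, then the number of such blocks of $T$ (respectively, of $T'$) is even or infinity. In particular, both $\dim\ker(\lambda-T)$ and $\operatorname{codim}\operatorname{rg}(\lambda-T)$ are zero, even or infinity for every $\lambda<0$.
   Context: Let $Y$ be a real Banach space and $X=Y+iY$ its complexification with norm $\|y_1+iy_2\|:=\sup_{t\in[0,2\pi]}\|\cos t\cdot y_1-\sin t\cdot y_2\|$. A bounded linear operator $T$ on $X$ is called real if $TY\subset Y$. The dual space is $X'=Y'+iY'$ and $T'$ denotes the adjoint of $T$ on $X'$. An operator $T$ on a Banach space $X$ has a (partial) Jordan block of dimension $d\in\mathbb{N}$ corresponding to (or "to") $\lambda\in\mathbb{C}$ if there exists a family of linearly independent vectors $x_1,\ldots,x_d\in X$ with $Tx_1=\lambda x_1$, $Tx_2=x_1+\lambda x_2$, $\ldots$, $Tx_d=x_{d-1}+\lambda x_d$. By the existence of several Jordan blocks of $T$ one means the existence of several such families which are (jointly) linearly independent; accordingly, the number of Jordan blocks of dimension $d$ to $\lambda$ is the maximal number of such families whose vectors are all together linearly independent (infinity if there is no finite maximum). $\ker$ and $\operatorname{rg}$ denote kernel and range, and $\operatorname{codim}(\operatorname{rg}T):=\dim(X/\operatorname{rg}T)$ (the algebraic dimension of the quotient); no distinction is made between infinite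 cardinalities. *)

theory Defs
  imports "HOL-Analysis.Analysis" "HOL-Library.Set_Algebras" "HOL-Library.Extended_Nat"
begin

section \<open>Complexification of a real normed space\<close>

text \<open>\<open>Cx y\<^sub>1 y\<^sub>2\<close> stands for $y_1 + i y_2$.\<close>

datatype 'a complexification = Cx (re_part: 'a) (im_part: 'a)

lemma complexification_eqI:
  "re_part x = re_part y \<Longrightarrow> im_part x = im_part y \<Longrightarrow> x = y"
  by (cases x; cases y) simp

instantiation complexification :: (real_vector) real_vector
begin

definition "0 = Cx 0 0"
definition "x + y = Cx (re_part x + re_part y) (im_part x + im_part y)"
definition "x - y = Cx (re_part x - re_part y) (im_part x - im_part y)"
definition "- x = Cx (- re_part x) (- im_part x)"
definition "r *\<^sub>R x = Cx (r *\<^sub>R re_part x) (r *\<^sub>R im_part x)"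

instance
  by standard
    (simp_all add: zero_complexification_def plus_complexification_def
      minus_complexification_def uminus_complexification_def scaleR_complexification_def
      algebra_simps)

end

lemma complexification_sel [simp]:
  "re_part 0 = 0" "im_part 0 = 0"
  "re_part (x + y) = re_part x + re_part y" "im_part (x + y) = im_part x + im_part y"
  "re_part (x - y) = re_part x - re_part y" "im_part (x - y) = im_part x - im_part y"
  "re_part (- x) = - re_part x" "im_part (- x) = - im_part x"
  "re_part (r *\<^sub>R x) = r *\<^sub>R re_part x" "im_part (r *\<^sub>R x) = r *\<^sub>R im_part x"
  by (simp_all add: zero_complexification_def plus_complexification_def
      minus_complexification_def uminus_complexification_def scaleR_complexification_def)

definition scaleC :: "complex \<Rightarrow> 'a::real_vector complexification \<Rightarrow> 'a complexification"
    (infixr "*\<^sub>C" 75)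
  where "c *\<^sub>C x = Cx (Re c *\<^sub>R re_part x - Im c *\<^sub>R im_part x)
                       (Re c *\<^sub>R im_part x + Im c *\<^sub>R re_part x)"

lemma scaleC_sel [simp]:
  "re_part (c *\<^sub>C x) = Re c *\<^sub>R re_part x - Im c *\<^sub>R im_part x"
  "im_part (c *\<^sub>C x) = Re c *\<^sub>R im_part x + Im c *\<^sub>R re_part x"
  by (simp_all add: scaleC_def)

lemma scaleR_scaleC: "r *\<^sub>R x = complex_of_real r *\<^sub>C x"
  by (rule complexification_eqI) simp_all

instantiation complexification :: (real_normed_vector) real_normed_vector
begin

definition
  "norm (x :: 'a complexification) = (SUP t\<in>{0..2 * pi}. norm (cos t *\<^sub>R re_part x - sin t *\<^sub>R im_part x))"

definition "dist x y = norm (x - y :: 'a complexification)"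

definition "sgn x = inverse (norm x) *\<^sub>R (x :: 'a complexification)"

definition "uniformity = (INF e\<in>{0<..}. principal {(x :: 'a complexification, y). dist x y < e})"

definition "open (U :: 'a complexification set) \<longleftrightarrow> (\<forall>x\<in>U. \<forall>\<^sub>F (x', y) in uniformity. x' = x \<longrightarrow> y \<in> U)"

lemma complexification_norm_bound:
  fixes x :: "'a complexification"
  shows "norm (cos t *\<^sub>R re_part x - sin t *\<^sub>R im_part x) \<le> norm (re_part x) + norm (im_part x)"
proof -
  have "norm (cos t *\<^sub>R re_part x - sin t *\<^sub>R im_part x)
      \<le> \<bar>cos t\<bar> * norm (re_part x) + \<bar>sin t\<bar> * norm (im_part x)"
    by (metis norm_scaleR norm_triangle_ineq4)
  also have "\<dots> \<le> 1 * norm (re_part x) + 1 * norm (im_part x)"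
    by (intro add_mono mult_right_mono) auto
  finally show ?thesis by simp
qed

lemma complexification_bdd:
  fixes x :: "'a complexification"
  shows "bdd_above ((\<lambda>t. norm (cos t *\<^sub>R re_part x - sin t *\<^sub>R im_part x)) ` A)"
  using complexification_norm_bound by (intro bdd_aboveI2)

lemma complexification_norm_upper:
  fixes x :: "'a complexification"
  assumes "t \<in> {0..2 * pi}"
  shows "norm (cos t *\<^sub>R re_part x - sin t *\<^sub>R im_part x) \<le> norm x"
  unfolding norm_complexification_def
  using complexification_bdd assms by (intro cSUP_upper)

lemma complexification_norm_least:
  fixes x :: "'a complexification"
  assumes "\<And>t. t \<in> {0..2 * pi} \<Longrightarrow> norm (cos t *\<^sub>R re_part x - sin t *\<^sub>R im_part x) \<le> B"
  shows "norm x \<le> B"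
  unfolding norm_complexification_def using assms by (intro cSUP_least) auto

lemma norm_re_part_le: "norm (re_part x) \<le> norm (x :: 'a complexification)"
  using complexification_norm_upper[of 0 x] by simp

lemma norm_im_part_le: "norm (im_part x) \<le> norm (x :: 'a complexification)"
  using complexification_norm_upper[of "pi / 2" x] by simp

lemma norm_complexification_le_add:
  "norm (x :: 'a complexification) \<le> norm (re_part x) + norm (im_part x)"
  by (intro complexification_norm_least complexification_norm_bound)

instance
proof
  fix x y :: "'a complexification" and r :: real
  show "norm x = 0 \<longleftrightarrow> x = 0"
  proof
    assume "norm x = 0"
    then show "x = 0"
      using norm_re_part_le[of x] norm_im_part_le[of x] by (intro complexification_eqI) auto
  next
    assume "x = 0"
    then show "norm x = 0"
      using norm_complexification_le_add[of x] norm_re_part_le[of x] by simp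
  qed
  show "norm (x + y) \<le> norm x + norm y"
  proof (rule complexification_norm_least)
    fix t assume t: "t \<in> {0..2 * pi}"
    have "cos t *\<^sub>R re_part (x + y) - sin t *\<^sub>R im_part (x + y) =
        (cos t *\<^sub>R re_part x - sin t *\<^sub>R im_part x) + (cos t *\<^sub>R re_part y - sin t *\<^sub>R im_part y)"
      by (simp add: algebra_simps)
    then show "norm (cos t *\<^sub>R re_part (x + y) - sin t *\<^sub>R im_part (x + y)) \<le> norm x + norm y"
      using complexification_norm_upper[OF t, of x] complexification_norm_upper[OF t, of y]
      by (metis add_mono norm_triangle_le)
  qed
  have scale: "norm (s *\<^sub>R z) \<le> \<bar>s\<bar> * norm z" for s :: real and z :: "'a complexification"
  proof (rule complexification_norm_least)
    fix t assume t: "t \<in> {0..2 * pi}"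
    have "cos t *\<^sub>R re_part (s *\<^sub>R z) - sin t *\<^sub>R im_part (s *\<^sub>R z) =
        s *\<^sub>R (cos t *\<^sub>R re_part z - sin t *\<^sub>R im_part z)"
      by (simp add: algebra_simps)
    then show "norm (cos t *\<^sub>R re_part (s *\<^sub>R z) - sin t *\<^sub>R im_part (s *\<^sub>R z)) \<le> \<bar>s\<bar> * norm z"
      using complexification_norm_upper[OF t, of z] by (simp add: mult_left_mono)
  qed
  show "norm (r *\<^sub>R x) = \<bar>r\<bar> * norm x"
  proof (cases "r = 0")
    case True
    then show ?thesis
      using norm_complexification_le_add[of "r *\<^sub>R x"] norm_re_part_le[of "r *\<^sub>R x"] by simp
  next
    case False
    then have "norm x \<le> inverse \<bar>r\<bar> * norm (r *\<^sub>R x)"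
      using scale[of "inverse r" "r *\<^sub>R x"] by simp
    with False have "\<bar>r\<bar> * norm x \<le> norm (r *\<^sub>R x)"
      by (simp add: field_simps)
    with scale[of r x] show ?thesis by simp
  qed
qed (simp_all add: dist_complexification_def sgn_complexification_def
      uniformity_complexification_def open_complexification_def)

end

lemma norm_scaleC:
  fixes x :: "'a::real_normed_vector complexification"
  shows "norm (c *\<^sub>C x) = cmod c * norm x"
proof -
  have le: "norm (u *\<^sub>C z) \<le> norm z" if u: "cmod u = 1"
    for u and z :: "'a complexification"
  proof (rule complexification_norm_least)
    fix t :: real
    let ?v = "cis t * u"
    have v: "(Re ?v)\<^sup>2 + (Im ?v)\<^sup>2 = 1"
      using u by (metis cmod_power2 mult_1 norm_cis norm_mult one_power2)
    obtain s where s: "0 \<le> s" "s < 2 * pi" "Re ?v = cos s" "Im ?v = sin s"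
      using sincos_total_2pi[OF v] by metis
    have "cos t *\<^sub>R re_part (u *\<^sub>C z) - sin t *\<^sub>R im_part (u *\<^sub>C z) =
        Re ?v *\<^sub>R re_part z - Im ?v *\<^sub>R im_part z"
      by (simp add: algebra_simps)
    then show "norm (cos t *\<^sub>R re_part (u *\<^sub>C z) - sin t *\<^sub>R im_part (u *\<^sub>C z)) \<le> norm z"
      using s complexification_norm_upper[of s z] by (simp only: s(3,4)) auto
  qed
  have comp: "a *\<^sub>C b *\<^sub>C z = (a * b) *\<^sub>C z" for a b and z :: "'a complexification"
    by (rule complexification_eqI) (simp_all add: algebra_simps)
  have eq: "norm (u *\<^sub>C z) = norm z" if u: "cmod u = 1" for u and z :: "'a complexification"
  proof (rule antisym)
    have "u \<noteq> 0" using u by auto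
    then have "inverse u *\<^sub>C u *\<^sub>C z = z"
      unfolding comp by (intro complexification_eqI) simp_all
    then show "norm z \<le> norm (u *\<^sub>C z)"
      using le[of "inverse u" "u *\<^sub>C z"] u by (simp add: norm_inverse)
  qed (rule le[OF u])
  have "c *\<^sub>C x = cmod c *\<^sub>R (cis (Arg c) *\<^sub>C x)"
    unfolding scaleR_scaleC comp using rcis_cmod_Arg[of c] by (simp add: rcis_def)
  then show ?thesis by (simp add: eq)
qed

instance complexification :: (banach) banach
proof
  fix X :: "nat \<Rightarrow> 'a complexification"
  assume X: "Cauchy X"
  have le: "dist (re_part x) (re_part y) \<le> dist x y" "dist (im_part x) (im_part y) \<le> dist x y"
    for x y :: "'a complexification"
    using norm_re_part_le[of "x - y"] norm_im_part_le[of "x - y"] by (simp_all add: dist_norm)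
  have "Cauchy (\<lambda>n. re_part (X n))" "Cauchy (\<lambda>n. im_part (X n))"
    using X le unfolding Cauchy_def by (meson order.strict_trans1)+
  then obtain a b where ab: "(\<lambda>n. re_part (X n)) \<longlonglongrightarrow> a" "(\<lambda>n. im_part (X n)) \<longlonglongrightarrow> b"
    by (meson Cauchy_convergent convergent_def)
  have "(\<lambda>n. norm (re_part (X n) - a) + norm (im_part (X n) - b)) \<longlonglongrightarrow> 0"
    using tendsto_add[OF ab[THEN LIM_zero, THEN tendsto_norm_zero]] by simp
  then have "(\<lambda>n. X n - Cx a b) \<longlonglongrightarrow> 0"
  proof (rule Lim_null_comparison[rotated], intro always_eventually allI)
    show "norm (X n - Cx a b) \<le> norm (re_part (X n) - a) + norm (im_part (X n) - b)" for n
      using norm_complexification_le_add[of "X n - Cx a b"] by simp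
  qed
  then have "X \<longlonglongrightarrow> Cx a b" by (rule LIM_zero_cancel)
  then show "convergent X" by (rule convergentI)
qed


section \<open>Jordan blocks, dimension and codimension\<close>

locale complex_vector_space = vector_space scale
  for scale :: "complex \<Rightarrow> 'b::ab_group_add \<Rightarrow> 'b" (infixr "*s" 75)
begin

text \<open>A family \<open>x\<close> indexed by \<open>I\<close> is linearly independent: no repetitions are allowed,
  which \<open>independent (x ` I)\<close> alone would not express.\<close>

definition independent_family :: "('i \<Rightarrow> 'b) \<Rightarrow> 'i set \<Rightarrow> bool" where
  "independent_family x I \<longleftrightarrow> inj_on x I \<and> independent (x ` I)"

definition jordan_block :: "('b \<Rightarrow> 'b) \<Rightarrow> complex \<Rightarrow> nat \<Rightarrow> (nat \<Rightarrow> 'b) \<Rightarrow> bool" where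
  "jordan_block T l d x \<longleftrightarrow>
     independent_family x {1..d} \<and>
     T (x 1) = l *s x 1 \<and>
     (\<forall>j\<in>{2..d}. T (x j) = x (j - 1) + l *s x j)"

definition has_jordan_block :: "('b \<Rightarrow> 'b) \<Rightarrow> complex \<Rightarrow> nat \<Rightarrow> bool" where
  "has_jordan_block T l d \<longleftrightarrow> (\<exists>x. jordan_block T l d x)"

definition has_jordan_blocks :: "('b \<Rightarrow> 'b) \<Rightarrow> complex \<Rightarrow> nat \<Rightarrow> nat \<Rightarrow> bool" where
  "has_jordan_blocks T l d n \<longleftrightarrow>
     (\<exists>x :: nat \<Rightarrow> nat \<Rightarrow> 'b.
        (\<forall>k<n. jordan_block T l d (x k)) \<and>
        independent_family (\<lambda>(k, j). x k j) ({..<n} \<times> {1..d}))"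

text \<open>In \<^typ>\<open>enat\<close>, the supremum of a nonempty set is its maximum if it is bounded, and
  \<open>\<infinity>\<close> otherwise.\<close>

definition number_of_jordan_blocks :: "('b \<Rightarrow> 'b) \<Rightarrow> complex \<Rightarrow> nat \<Rightarrow> enat" where
  "number_of_jordan_blocks T l d = (SUP n\<in>{n. has_jordan_blocks T l d n}. enat n)"

text \<open>The library's \<open>dim\<close> is \<open>0\<close> on infinite-dimensional subspaces.\<close>

definition edim :: "'b set \<Rightarrow> enat" where
  "edim V = (if \<exists>B. finite B \<and> V \<subseteq> span B then enat (dim V) else \<infinity>)"

definition kernel :: "('b \<Rightarrow> 'b) \<Rightarrow> 'b set" where
  "kernel T = {x. T x = 0}"

text \<open>The quotient space by a subspace \<open>W\<close>, with cosets as elements.  Its operations are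
  the elementwise sum \<open>A + B\<close> and the scalar multiple \<open>c A + W\<close> (where \<open>+ W\<close> matters only for
  \<open>c = 0\<close>), and its zero is \<open>W\<close>.  Hence the linear combination of the cosets \<open>A \<in> F\<close> with
  coefficients \<open>c A\<close> is the elementwise sum below; the final \<open>+ W\<close> takes care of zero
  coefficients and of \<open>F = {}\<close>.\<close>

definition cosets :: "'b set \<Rightarrow> 'b set set" where
  "cosets W = range (\<lambda>x. x +o W)"

definition coset_combination :: "'b set \<Rightarrow> ('b set \<Rightarrow> complex) \<Rightarrow> 'b set set \<Rightarrow> 'b set" where
  "coset_combination W c F = (\<Sum>A\<in>F. (\<lambda>x. c A *s x) ` A) + W"

definition quotient_basis :: "'b set \<Rightarrow> 'b set set \<Rightarrow> bool" where
  "quotient_basis W C \<longleftrightarrow>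
     C \<subseteq> cosets W \<and>
     (\<forall>F c. finite F \<and> F \<subseteq> C \<and> coset_combination W c F = W \<longrightarrow> (\<forall>A\<in>F. c A = 0)) \<and>
     (\<forall>A\<in>cosets W. \<exists>F c. finite F \<and> F \<subseteq> C \<and> coset_combination W c F = A)"

text \<open>All finite bases of the quotient have the same cardinality; if there is none, the infimum
  of the empty set is \<open>\<infinity>\<close>.\<close>

definition codim :: "'b set \<Rightarrow> enat" where
  "codim W = (INF C\<in>{C. finite C \<and> quotient_basis W C}. enat (card C))"

end

global_interpretation cx: complex_vector_space "scaleC :: complex \<Rightarrow> 'a::real_vector complexification \<Rightarrow> _"
  by standard (simp_all add: complexification_eqI algebra_simps)


section \<open>Real operators and adjoints\<close>

definition bounded_complex_linear ::
    "('a::real_normed_vector complexification \<Rightarrow> 'b::real_normed_vector complexification) \<Rightarrow> bool"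
  where "bounded_complex_linear T \<longleftrightarrow>
     bounded_linear T \<and> (\<forall>c x. T (c *\<^sub>C x) = c *\<^sub>C T x)"

definition real_points :: "'a::real_vector complexification set" where
  "real_points = range (\<lambda>y. Cx y 0)"

definition real_operator ::
    "('a::real_normed_vector complexification \<Rightarrow> 'a complexification) \<Rightarrow> bool"
  where "real_operator T \<longleftrightarrow> bounded_complex_linear T \<and> T ` real_points \<subseteq> real_points"

text \<open>The dual of the complexification of \<open>Y\<close> is the complexification of the dual of \<open>Y\<close>:
  $f_1 + i f_2$ acts by $(f_1 + i f_2)(y_1 + i y_2) = f_1 y_1 - f_2 y_2 + i (f_1 y_2 + f_2 y_1)$.
  By \<open>dual_apply_bij\<close> below these are exactly the bounded complex-linear functionals.\<close>

type_synonym 'a cx_dual = "('a \<Rightarrow>\<^sub>L real) complexification"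

definition dual_apply :: "'a::real_normed_vector cx_dual \<Rightarrow> 'a complexification \<Rightarrow> complex" where
  "dual_apply f x =
     Complex (re_part f (re_part x) - im_part f (im_part x))
             (re_part f (im_part x) + im_part f (re_part x))"

definition dual_adjoint ::
    "('a::real_normed_vector complexification \<Rightarrow> 'a complexification) \<Rightarrow> 'a cx_dual \<Rightarrow> 'a cx_dual"
  where "dual_adjoint T f = (THE g. \<forall>x. dual_apply g x = dual_apply f (T x))"

definition bounded_functional :: "('a::real_normed_vector complexification \<Rightarrow> complex) \<Rightarrow> bool" where
  "bounded_functional h \<longleftrightarrow> bounded_linear h \<and> (\<forall>c x. h (c *\<^sub>C x) = c * h x)"

lemma bounded_linear_re_part: "bounded_linear (re_part :: 'a::real_normed_vector complexification \<Rightarrow> 'a)"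
  using norm_re_part_le by (intro bounded_linear_intro[where K = 1]) auto

lemma bounded_linear_im_part: "bounded_linear (im_part :: 'a::real_normed_vector complexification \<Rightarrow> 'a)"
  using norm_im_part_le by (intro bounded_linear_intro[where K = 1]) auto

lemma bounded_linear_Cx_0: "bounded_linear (\<lambda>y :: 'a::real_normed_vector. Cx y 0)"
proof (rule bounded_linear_intro[where K = 1])
  show "norm (Cx y 0) \<le> norm y * 1" for y :: 'a
    using norm_complexification_le_add[of "Cx y 0"] by simp
qed (auto intro: complexification_eqI)

lemma dual_apply_bij:
  "bij_betw dual_apply (UNIV :: 'a::real_normed_vector cx_dual set) {h. bounded_functional h}"
proof (rule bij_betw_imageI)
  show "inj (dual_apply :: 'a cx_dual \<Rightarrow> _)"
  proof (rule injI)
    fix f g :: "'a cx_dual"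
    assume eq: "dual_apply f = dual_apply g"
    have "re_part f y = re_part g y \<and> im_part f y = im_part g y" for y
      using fun_cong[OF eq, of "Cx y 0"] by (simp add: dual_apply_def)
    then show "f = g"
      by (intro complexification_eqI blinfun_eqI) auto
  qed
  have "bounded_functional (dual_apply f)" for f :: "'a cx_dual"
  proof -
    have eq: "dual_apply f = (\<lambda>x.
        complex_of_real (re_part f (re_part x) - im_part f (im_part x)) +
        \<i> * complex_of_real (re_part f (im_part x) + im_part f (re_part x)))"
      by (auto simp: dual_apply_def complex_eq_iff)
    have "bounded_linear (dual_apply f)"
      unfolding eq
      by (intro bounded_linear_add bounded_linear_const_mult bounded_linear_sub
          bounded_linear_compose[OF bounded_linear_of_real]
          bounded_linear_compose[OF blinfun.bounded_linear_right]
          bounded_linear_re_part bounded_linear_im_part)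
    moreover have "dual_apply f (c *\<^sub>C x) = c * dual_apply f x" for c x
      by (simp add: dual_apply_def complex_eq_iff blinfun.diff_right blinfun.add_right
          blinfun.scaleR_right algebra_simps)
    ultimately show ?thesis by (simp add: bounded_functional_def)
  qed
  moreover have "h \<in> range (dual_apply :: 'a cx_dual \<Rightarrow> _)" if h: "bounded_functional h" for h
  proof -
    have lin: "bounded_linear h" and sc: "\<And>c x. h (c *\<^sub>C x) = c * h x"
      using h by (auto simp: bounded_functional_def)
    note hC = bounded_linear_compose[OF lin bounded_linear_Cx_0]
    define f where "f = Cx (Blinfun (\<lambda>y. Re (h (Cx y 0)))) (Blinfun (\<lambda>y. Im (h (Cx y 0))))"
    have f: "re_part f y = Re (h (Cx y 0))" "im_part f y = Im (h (Cx y 0))" for y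
      unfolding f_def
      using bounded_linear_compose[OF bounded_linear_Re hC]
        bounded_linear_compose[OF bounded_linear_Im hC]
      by (simp_all add: bounded_linear_Blinfun_apply)
    have "h x = dual_apply f x" for x
    proof -
      have "x = Cx (re_part x) 0 + \<i> *\<^sub>C Cx (im_part x) 0"
        by (rule complexification_eqI) simp_all
      then have "h x = h (Cx (re_part x) 0) + \<i> * h (Cx (im_part x) 0)"
        using linear_add[OF bounded_linear.linear[OF lin]] sc by metis
      then show ?thesis
        by (simp add: dual_apply_def f complex_eq_iff)
    qed
    then show ?thesis by blast
  qed
  ultimately show "range (dual_apply :: 'a cx_dual \<Rightarrow> _) = {h. bounded_functional h}"
    by blast
qed

lemma dual_apply_adjoint:
  assumes "bounded_complex_linear T"
  shows "dual_apply (dual_adjoint T f) x = dual_apply f (T x)"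
proof -
  have f: "bounded_functional (dual_apply f)"
    using dual_apply_bij bij_betwE by blast
  have "bounded_functional (\<lambda>x. dual_apply f (T x))"
    using f assms unfolding bounded_functional_def bounded_complex_linear_def
    by (auto intro: bounded_linear_compose)
  then obtain g where g: "dual_apply g = (\<lambda>x. dual_apply f (T x))"
    using dual_apply_bij by (metis (mono_tags, lifting) bij_betw_imp_surj_on imageE mem_Collect_eq)
  have "dual_adjoint T f = g"
    unfolding dual_adjoint_def
  proof (rule the_equality)
    show "\<forall>x. dual_apply g x = dual_apply f (T x)" using g by simp
  next
    fix g' assume "\<forall>x. dual_apply g' x = dual_apply f (T x)"
    then have "dual_apply g' = dual_apply g" using g by auto
    then show "g' = g" using dual_apply_bij by (metis UNIV_I bij_betw_imp_inj_on inj_onD)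
  qed
  then show ?thesis using g by simp
qed

definition even_or_infinite :: "enat \<Rightarrow> bool" where
  "even_or_infinite n \<longleftrightarrow> n = \<infinity> \<or> (\<exists>k. even k \<and> n = enat k)"

end

theory Submission
  imports Defs
begin

text \<open>Compose the real square root \<open>S\<close> with the complex conjugation of \<open>X\<close>.  As \<open>S\<close> is real, it
  commutes with conjugation, so \<open>J x = S (conjugate x)\<close> is an antilinear map with \<open>J \<circ> J = T\<close>.
  On a \<open>J\<close>-invariant subspace on which \<open>J \<circ> J\<close> is multiplication by a number \<open>l < 0\<close>, the map \<open>J\<close>
  has no eigenvectors: \<open>J x = c x\<close> would give \<open>J (J x) = \<bar>c\<bar>\<^sup>2 x\<close>.  Hence \<open>x\<close> and \<open>J x\<close> are
  independent for every \<open>x \<noteq> 0\<close>, and basis vectors can be collected in pairs: a finite dimension is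
  even (\<open>even_dim_antilinear\<close>).  Everything is reduced to this parity argument.

  Let \<open>N = T - l\<close>.  As \<open>l\<close> is real, \<open>J\<close> commutes with \<open>N\<close>, so all subspaces built from
  kernels and ranges of powers of \<open>N\<close> are \<open>J\<close>-invariant.  The kernel of \<open>N\<close> is an immediate case.
  The number of Jordan blocks of dimension \<open>d\<close> is the dimension of \<open>N\<^sup>d\<^sup>-\<^sup>1 (ker N\<^sup>d)\<close>, the
  space of eigenvectors at the bottom of chains of length \<open>d\<close>
  (\<open>number_of_jordan_blocks_eq_edim\<close>).  For the codimension, \<open>J\<close> acts on the quotient by the range
  of \<open>N\<close>, where its square is \<open>l\<close>; the quotient is replaced by a complement onto which one projects
  (\<open>even_or_infinite_codim_antilinear\<close>).

  These arguments are purely algebraic, so they apply to the adjoint as well: it is the square of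
  the antilinear map \<open>f \<mapsto> S' (conjugate f)\<close> on the dual space.\<close>

(* The symbol is used below for the scalar multiplication of the locale. *)
no_notation vector_scalar_mult (infixl "*s" 70)

section \<open>Antilinear maps with negative square\<close>

context complex_vector_space
begin

definition antilinear :: "('b \<Rightarrow> 'b) \<Rightarrow> bool" where
  "antilinear J \<longleftrightarrow> (\<forall>x y. J (x + y) = J x + J y) \<and> (\<forall>c x. J (c *s x) = cnj c *s J x)"

lemma antilinear_simps:
  assumes "antilinear J"
  shows "J (x + y) = J x + J y" "J (c *s x) = cnj c *s J x" "J 0 = 0"
    "J (- x) = - J x" "J (x - y) = J x - J y"
proof -
  show add: "J (x + y) = J x + J y" and scale: "J (c *s x) = cnj c *s J x" for x y c
    using assms by (simp_all add: antilinear_def)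
  show "J 0 = 0" using scale[of 0 0] by simp
  show neg: "J (- x) = - J x" for x using scale[of "-1" x] by simp
  show "J (x - y) = J x - J y" using add[of x "- y"] neg[of y] by simp
qed

lemma linear_square_antilinear:
  assumes "antilinear J"
  shows "Vector_Spaces.linear (*s) (*s) (\<lambda>x. J (J x))"
  by unfold_locales (simp_all add: antilinear_simps[OF assms])

text \<open>A vector with \<open>J (J x) = l x\<close> outside an invariant subspace cannot be an eigenvector modulo that subspace:
  \<open>J x \<equiv> c x\<close> would give \<open>J\<^sup>2 x \<equiv> \<bar>c\<bar>\<^sup>2 x\<close>, but \<open>\<bar>c\<bar>\<^sup>2\<close> is not the negative number \<open>l\<close>.
  Antilinearity is what turns \<open>c\<^sup>2\<close> into \<open>\<bar>c\<bar>\<^sup>2\<close>.\<close>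

lemma antilinear_no_eigenvector:
  assumes J: "antilinear J" and D: "\<And>z. z \<in> span D \<Longrightarrow> J z \<in> span D"
    and JJ: "J (J x) = complex_of_real l *s x" and l: "l < 0" and x: "x \<notin> span D"
  shows "J x \<notin> span (insert x D)"
proof
  assume "J x \<in> span (insert x D)"
  then obtain c where c: "J x - c *s x \<in> span D"
    by (auto simp: span_breakdown_eq)
  have "J (J x - c *s x) + cnj c *s (J x - c *s x) \<in> span D"
    using c D by (intro span_add span_scale)
  also have "J (J x - c *s x) + cnj c *s (J x - c *s x) = (complex_of_real l - cnj c * c) *s x"
    by (simp add: antilinear_simps[OF J] JJ algebra_simps)
  finally have *: "(complex_of_real l - cnj c * c) *s x \<in> span D" .
  have "Re (complex_of_real l - cnj c * c) < 0"
    using l by (simp add: add_nonneg_pos add.commute) (smt (verit) zero_le_square)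
  then have "complex_of_real l - cnj c * c \<noteq> 0" by force
  then have "x = inverse (complex_of_real l - cnj c * c) *s ((complex_of_real l - cnj c * c) *s x)"
    by simp
  with * span_scale x show False by metis
qed

text \<open>Such a \<open>V\<close> is a quaternionic vector space up to scaling, with \<open>J\<close> in the role of the
  unit \<open>j\<close>.  A largest independent set of even size that spans a \<open>J\<close>-invariant subspace must
  span \<open>V\<close>: any vector \<open>x\<close> outside it could be adjoined together with \<open>J x\<close>.\<close>

lemma even_dim_antilinear:
  assumes J: "antilinear J" and inv: "\<And>x. x \<in> V \<Longrightarrow> J x \<in> V"
    and JJ: "\<And>x. x \<in> V \<Longrightarrow> J (J x) = complex_of_real l *s x" and l: "l < 0"
    and B: "finite B" "V \<subseteq> span B"
  shows "even (dim V)"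
proof -
  define P where "P D \<longleftrightarrow> independent D \<and> D \<subseteq> V \<and> even (card D) \<and> (\<forall>z\<in>span D. J z \<in> span D)" for D
  have fin: "finite D \<and> card D \<le> card B" if "P D" for D
    using independent_span_bound[OF B(1), of D] that B(2) unfolding P_def by auto
  have "P {}" by (simp add: P_def antilinear_simps[OF J] independent_empty)
  then have "\<exists>D. P D \<and> (\<forall>E. P E \<longrightarrow> card E \<le> card D)"
    by (rule ex_has_greatest_nat[where b = "Suc (card B)"]) (use fin in \<open>simp add: less_Suc_eq_le\<close>)
  then obtain D where D: "P D" and max: "\<And>E. P E \<Longrightarrow> card E \<le> card D"
    by blast
  have "V \<subseteq> span D"
  proof (rule ccontr)
    assume "\<not> V \<subseteq> span D"
    then obtain x where x: "x \<in> V" "x \<notin> span D" by auto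
    have Jx: "J x \<notin> span (insert x D)"
      using D x JJ l by (intro antilinear_no_eigenvector[OF J]) (auto simp: P_def)
    let ?E = "insert (J x) (insert x D)"
    have card: "card ?E = Suc (Suc (card D))"
      using fin[OF D] x(2) Jx span_base by (metis card_insert_disjoint finite_insert)
    have "P ?E"
      unfolding P_def
    proof (intro conjI ballI)
      show "independent ?E" using D x(2) Jx by (simp add: P_def independent_insertI)
      show "?E \<subseteq> V" using D x(1) inv by (auto simp: P_def)
      show "even (card ?E)" using D card by (simp add: P_def)
      fix z assume "z \<in> span ?E"
      then obtain a b where ab: "z - a *s J x - b *s x \<in> span D"
        by (auto simp: span_breakdown_eq)
      let ?w = "z - a *s J x - b *s x"
      have "J ?w \<in> span ?E" using ab D span_mono[of D ?E] unfolding P_def by blast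
      moreover have "x \<in> span ?E" "J x \<in> span ?E" by (auto intro: span_base)
      ultimately have "J ?w + cnj a *s (complex_of_real l *s x) + cnj b *s J x \<in> span ?E"
        by (intro span_add span_scale)
      also have "J ?w + cnj a *s (complex_of_real l *s x) + cnj b *s J x = J z"
        using JJ[OF x(1)] by (simp add: antilinear_simps[OF J])
      finally show "J z \<in> span ?E" .
    qed
    with max card show False by fastforce
  qed
  with D have "dim V = card D" unfolding P_def by (intro dim_unique) auto
  with D show ?thesis by (simp add: P_def)
qed

lemma even_or_infinite_edim_antilinear:
  assumes "antilinear J" and "\<And>x. x \<in> V \<Longrightarrow> J x \<in> V"
    and "\<And>x. x \<in> V \<Longrightarrow> J (J x) = complex_of_real l *s x" and "l < 0"
  shows "even_or_infinite (edim V)"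
  using even_dim_antilinear[OF assms] by (auto simp: edim_def even_or_infinite_def)

end


section \<open>Codimension of an invariant subspace\<close>

context complex_vector_space
begin

lemma projection_along:
  assumes U: "subspace U" and W: "subspace W" and UW: "U \<inter> W \<subseteq> {0}"
    and ex: "\<And>x. \<exists>u\<in>U. x - u \<in> W"
  obtains p where "Vector_Spaces.linear (*s) (*s) p" "\<And>x. p x \<in> U" "\<And>x. x - p x \<in> W"
    "\<And>x. x \<in> U \<Longrightarrow> p x = x" "\<And>x. x \<in> W \<Longrightarrow> p x = 0"
proof -
  obtain p where p: "\<And>x. p x \<in> U" "\<And>x. x - p x \<in> W" using ex by metis
  have uniq: "p x = u" if "u \<in> U" "x - u \<in> W" for x u
  proof -
    have "p x - u \<in> U" by (rule subspace_diff[OF U p(1) that(1)])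
    moreover have "(x - u) - (x - p x) \<in> W" by (rule subspace_diff[OF W that(2) p(2)])
    ultimately show ?thesis using UW by auto
  qed
  have "p (x + y) = p x + p y" for x y
    using subspace_add[OF U p(1) p(1)] subspace_add[OF W p(2)[of x] p(2)[of y]]
    by (intro uniq) (auto simp: algebra_simps)
  moreover have "p (c *s x) = c *s p x" for c x
    using subspace_scale[OF U p(1)] subspace_scale[OF W p(2)[of x], of c]
    by (intro uniq) (auto simp: algebra_simps)
  ultimately have "Vector_Spaces.linear (*s) (*s) p" by unfold_locales
  moreover have "p x = x" if "x \<in> U" for x using that subspace_0[OF W] by (intro uniq) auto
  moreover have "p x = 0" if "x \<in> W" for x using that subspace_0[OF U] by (intro uniq) auto
  ultimately show ?thesis using that p by blast
qed

text \<open>This turns linear combinations of cosets into linear combinations of representatives.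
  Scaling by \<open>0\<close> collapses a coset to \<open>{0}\<close>; the final summand \<open>W\<close> restores it, so every term
  of the sum has to be followed together with that summand.\<close>

lemma coset_combination_eq:
  assumes W: "subspace W" and fin: "finite F" and r: "\<And>A. A \<in> F \<Longrightarrow> A = r A +o W"
  shows "coset_combination W c F = (\<Sum>A\<in>F. c A *s r A) +o W"
proof -
  have WW: "W + W = W"
    using subspace_add[OF W] set_zero_plus2[OF subspace_0[OF W], of W]
    by (intro antisym) (auto elim: set_plus_elim)
  have img: "(\<lambda>x. a *s x) ` (v +o W) + W = (a *s v) +o W" for a v
  proof -
    have "(\<lambda>x. a *s x) ` (v +o W) = (a *s v) +o ((\<lambda>x. a *s x) ` W)"
      by (auto simp: elt_set_plus_def scale_right_distrib intro!: image_eqI)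
    moreover have "(\<lambda>x. a *s x) ` W + W = W"
    proof
      have "(\<lambda>x. a *s x) ` W + W \<subseteq> W + W"
        using subspace_scale[OF W] by (intro set_plus_mono2) auto
      then show "(\<lambda>x. a *s x) ` W + W \<subseteq> W" using WW by simp
      show "W \<subseteq> (\<lambda>x. a *s x) ` W + W"
        using subspace_0[OF W] by (intro set_zero_plus2) force
    qed
    ultimately show ?thesis by (simp add: set_plus_rearrange3)
  qed
  show ?thesis
    using fin r
  proof (induction F)
    case empty
    then show ?case by (simp add: coset_combination_def)
  next
    case (insert A F)
    let ?I = "\<lambda>A. (\<lambda>x. c A *s x) ` A"
    have "coset_combination W c (insert A F) = ?I A + coset_combination W c F"
      using insert.hyps by (simp add: coset_combination_def add.assoc)
    also have "\<dots> = ?I A + ((\<Sum>A\<in>F. c A *s r A) +o W)" using insert by simp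
    also have "\<dots> = (\<Sum>A\<in>F. c A *s r A) +o (?I A + W)"
      by (metis add.commute set_plus_rearrange3)
    also have "?I A + W = (c A *s r A) +o W"
      using img[of "c A" "r A"] insert.prems[of A] by simp
    finally show ?case
      using insert.hyps by (simp add: set_plus_rearrange2 add.commute)
  qed
qed

lemma coset_eq_subspace_iff:
  assumes "subspace W"
  shows "x +o W = W \<longleftrightarrow> x \<in> W"
proof
  assume "x +o W = W"
  then show "x \<in> W" using set_plus_intro2[OF subspace_0[OF assms], of x] by simp
next
  assume x: "x \<in> W"
  show "x +o W = W"
  proof
    show "x +o W \<subseteq> W" using subspace_add[OF assms x] by (auto simp: elt_set_plus_def)
    show "W \<subseteq> x +o W" using subspace_diff[OF assms _ x] set_minus_imp_plus by blast
  qed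
qed

text \<open>Representatives of the cosets in a finite basis of the quotient form a basis of a
  complement of \<open>W\<close>.  This moves the computation of the codimension into the space itself.\<close>

lemma quotient_basis_complement:
  assumes W: "subspace W" and C: "finite C" "quotient_basis W C"
  obtains B where "finite B" "independent B" "card B = card C" "span B \<inter> W \<subseteq> {0}"
    "\<And>x. \<exists>u\<in>span B. x - u \<in> W"
proof -
  have "\<forall>A\<in>C. \<exists>v. A = v +o W"
    using C(2) by (auto simp: quotient_basis_def cosets_def)
  then obtain r where r: "\<And>A. A \<in> C \<Longrightarrow> A = r A +o W" by metis
  have comb: "coset_combination W c F = (\<Sum>A\<in>F. c A *s r A) +o W" if "F \<subseteq> C" for c F
    by (rule coset_combination_eq[OF W finite_subset[OF that C(1)]], rule r) (use that in blast)
  have zero: "c A = 0" if sum: "(\<Sum>A\<in>C. c A *s r A) \<in> W" and A: "A \<in> C" for c A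
  proof -
    have "coset_combination W c C = W"
      using comb[OF order_refl, of c] sum coset_eq_subspace_iff[OF W] by simp
    then show ?thesis using C A unfolding quotient_basis_def by (meson order_refl)
  qed
  have inj: "inj_on r C" using r by (metis inj_onI)
  have sum: "(\<Sum>b\<in>r ` C. u b *s b) = (\<Sum>A\<in>C. u (r A) *s r A)" for u
    using inj by (simp add: sum.reindex)
  have u0: "u b = 0" if "(\<Sum>b\<in>r ` C. u b *s b) \<in> W" "b \<in> r ` C" for u b
    using that zero[of "\<lambda>A. u (r A)"] sum by auto
  have span: "span (r ` C) = range (\<lambda>u. \<Sum>b\<in>r ` C. u b *s b)"
    using C(1) by (intro span_finite) simp
  show thesis
  proof
    show "finite (r ` C)" using C by simp
    show "independent (r ` C)"
      using C(1) u0 subspace_0[OF W] by (intro independent_if_scalars_zero) auto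
    show "card (r ` C) = card C" using inj by (rule card_image)
    show "span (r ` C) \<inter> W \<subseteq> {0}"
    proof
      fix x assume x: "x \<in> span (r ` C) \<inter> W"
      then obtain u where u: "x = (\<Sum>b\<in>r ` C. u b *s b)" using span by blast
      with x u0[of u] show "x \<in> {0}" by (auto intro!: sum.neutral)
    qed
    fix x
    have "x +o W \<in> cosets W" by (simp add: cosets_def)
    then obtain F c where F: "F \<subseteq> C" "coset_combination W c F = x +o W"
      using C(2) unfolding quotient_basis_def by metis
    have "x \<in> x +o W" using set_plus_intro2[OF subspace_0[OF W], of x] by simp
    then have "x - (\<Sum>A\<in>F. c A *s r A) \<in> W"
      using F comb[of F c] by (metis set_plus_imp_minus)
    moreover have "(\<Sum>A\<in>F. c A *s r A) \<in> span (r ` C)"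
      using F(1) by (intro span_sum span_scale span_base) auto
    ultimately show "\<exists>u\<in>span (r ` C). x - u \<in> W" by blast
  qed
qed

text \<open>The quotient by \<open>W\<close> is modelled by a complement \<open>U\<close>: following \<open>J\<close> by the projection
  onto \<open>U\<close> along \<open>W\<close> gives an antilinear map of \<open>U\<close> whose square is exactly \<open>l\<close>.\<close>

lemma even_or_infinite_codim_antilinear:
  assumes J: "antilinear J" and W: "subspace W" and inv: "\<And>x. x \<in> W \<Longrightarrow> J x \<in> W"
    and JJ: "\<And>x. J (J x) - complex_of_real l *s x \<in> W" and l: "l < 0"
  shows "even_or_infinite (codim W)"
proof (cases "{C. finite C \<and> quotient_basis W C} = {}")
  case True
  then show ?thesis by (simp only: codim_def even_or_infinite_def) (simp add: top_enat_def)
next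
  case False
  \<comment> \<open>A nonempty infimum in \<^typ>\<open>enat\<close> is attained, so some finite basis has \<open>codim W\<close> elements.\<close>
  let ?S = "(\<lambda>C. enat (card C)) ` {C. finite C \<and> quotient_basis W C}"
  from False obtain n where "n \<in> ?S" by blast
  then have "Inf ?S \<in> ?S" by (rule wellorder_InfI)
  then obtain C where C: "finite C" "quotient_basis W C" and codim: "codim W = enat (card C)"
    unfolding codim_def by auto
  obtain B where B: "finite B" "independent B" "card B = card C" "span B \<inter> W \<subseteq> {0}"
    "\<And>x. \<exists>u\<in>span B. x - u \<in> W"
    using quotient_basis_complement[OF W C] by metis
  obtain p where p: "Vector_Spaces.linear (*s) (*s) p" "\<And>x. p x \<in> span B" "\<And>x. x - p x \<in> W"
    "\<And>x. x \<in> span B \<Longrightarrow> p x = x" "\<And>x. x \<in> W \<Longrightarrow> p x = 0"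
    using projection_along[OF subspace_span W B(4,5)] by metis
  interpret p: Vector_Spaces.linear "(*s)" "(*s)" p by (rule p(1))
  have "even (dim (span B))"
  proof (rule even_dim_antilinear[OF _ _ _ l B(1) order_refl])
    show "antilinear (\<lambda>x. p (J x))"
      by (simp add: antilinear_def antilinear_simps[OF J] p.add p.scale)
    show "p (J x) \<in> span B" for x by (rule p(2))
    fix x assume x: "x \<in> span B"
    \<comment> \<open>Since \<open>J\<close> preserves \<open>W\<close>, the inner projection changes \<open>J (J x)\<close> only by an element of \<open>W\<close>,
      which the outer projection removes.\<close>
    have eq: "p y = p z" if "y - z \<in> W" for y z
      using p(5)[OF that] by (simp add: p.diff)
    have "J (J x) - J (p (J x)) \<in> W"
      using inv[OF p(3)[of "J x"]] by (simp add: antilinear_simps[OF J])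
    then have "p (J (p (J x))) = p (J (J x))" by (rule eq[symmetric])
    also have "\<dots> = p (complex_of_real l *s x)" by (rule eq[OF JJ])
    also have "\<dots> = complex_of_real l *s x" using x by (simp add: p.scale p(4))
    finally show "p (J (p (J x))) = complex_of_real l *s x" .
  qed
  then show ?thesis
    using B(2,3) codim by (simp add: dim_eq_card_independent even_or_infinite_def)
qed

end


section \<open>Counting Jordan blocks\<close>

context complex_vector_space
begin

text \<open>The number of Jordan blocks is a supremum over numbers of independent families, so the
  dimension is brought into the same form.\<close>

lemma edim_eq_SUP_independent:
  "edim V = (SUP n\<in>{card A |A. finite A \<and> A \<subseteq> V \<and> independent A}. enat n)"
    (is "_ = (SUP n\<in>?S. enat n)")
proof (cases "\<exists>B. finite B \<and> V \<subseteq> span B")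
  case True
  then obtain B where B: "finite B" "V \<subseteq> span B" by blast
  obtain D where D: "D \<subseteq> V" "independent D" "V \<subseteq> span D" "card D = dim V"
    by (rule basis_exists)
  have "finite D" using independent_span_bound[OF B(1) D(2)] D(1) B(2) by auto
  then have "dim V \<in> ?S" using D by (auto intro!: exI[of _ D])
  moreover have "n \<le> dim V" if "n \<in> ?S" for n
    using that independent_span_bound[OF \<open>finite D\<close>] D by fastforce
  ultimately have "(SUP n\<in>?S. enat n) = enat (dim V)"
    by (intro antisym SUP_least SUP_upper) auto
  with True show ?thesis by (simp add: edim_def)
next
  case False
  obtain D where D: "D \<subseteq> V" "independent D" "V \<subseteq> span D"
    by (rule maximal_independent_subset)
  have "infinite D" using False D(3) by blast
  have "n \<in> ?S" for n
  proof -
    obtain A where "finite A" "card A = n" "A \<subseteq> D"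
      using infinite_arbitrarily_large[OF \<open>infinite D\<close>] by blast
    then show ?thesis using D(1) independent_mono[OF D(2), of A] by (auto intro!: exI[of _ A])
  qed
  then have "?S = UNIV" by blast
  moreover have "(SUP n. enat n) = \<infinity>"
  proof (rule ccontr)
    assume "(SUP n. enat n) \<noteq> \<infinity>"
    then obtain m where m: "(SUP n. enat n) = enat m" by auto
    have "enat (Suc m) \<le> (SUP n. enat n)" by (rule SUP_upper) simp
    with m show False by simp
  qed
  ultimately show ?thesis using False by (simp add: edim_def)
qed

lemma independent_family_iff:
  assumes "finite I"
  shows "independent_family x I \<longleftrightarrow> (\<forall>c. (\<Sum>i\<in>I. c i *s x i) = 0 \<longrightarrow> (\<forall>i\<in>I. c i = 0))"
proof
  assume *: "independent_family x I"
  then have inj: "inj_on x I" and ind: "independent (x ` I)" by (auto simp: independent_family_def)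
  show "\<forall>c. (\<Sum>i\<in>I. c i *s x i) = 0 \<longrightarrow> (\<forall>i\<in>I. c i = 0)"
  proof (intro allI impI ballI)
    fix c i assume c: "(\<Sum>i\<in>I. c i *s x i) = 0" and i: "i \<in> I"
    have "(\<Sum>v\<in>x ` I. c (inv_into I x v) *s v) = 0"
      using inj c by (simp add: sum.reindex)
    then have "c (inv_into I x (x i)) = 0"
      using ind i assms by (intro independentD[where u = "\<lambda>v. c (inv_into I x v)"]) auto
    then show "c i = 0" using inj i by simp
  qed
next
  assume *: "\<forall>c. (\<Sum>i\<in>I. c i *s x i) = 0 \<longrightarrow> (\<forall>i\<in>I. c i = 0)"
  have inj: "inj_on x I"
  proof (rule inj_onI, rule ccontr)
    fix i j assume ij: "i \<in> I" "j \<in> I" "x i = x j" "i \<noteq> j"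
    let ?c = "\<lambda>k. if k = i then 1 else if k = j then - 1 else (0 :: complex)"
    have "(\<Sum>k\<in>I. ?c k *s x k) = (\<Sum>k\<in>{i, j}. ?c k *s x k)"
      using ij assms by (intro sum.mono_neutral_right) auto
    also have "\<dots> = 0" using ij by simp
    finally show False using *[rule_format, of "?c" i] ij(1) by simp
  qed
  moreover have "independent (x ` I)"
  proof (rule independent_if_scalars_zero)
    fix f v assume "(\<Sum>v\<in>x ` I. f v *s v) = 0" "v \<in> x ` I"
    then show "f v = 0" using *[rule_format, of "\<lambda>i. f (x i)"] inj by (auto simp: sum.reindex)
  qed (use assms in simp)
  ultimately show "independent_family x I" by (simp add: independent_family_def)
qed

lemma independent_family_subset:
  "independent_family x I \<Longrightarrow> K \<subseteq> I \<Longrightarrow> independent_family x K"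
  unfolding independent_family_def by (meson image_mono independent_mono inj_on_subset)

lemma independent_family_image:
  "inj_on f K \<Longrightarrow> independent_family x (f ` K) \<longleftrightarrow> independent_family (\<lambda>k. x (f k)) K"
  unfolding independent_family_def by (auto simp: inj_on_def image_image)

text \<open>With \<open>N = T - l\<close> and \<open>d \<ge> 1\<close>, these are the eigenvectors \<open>x\<^sub>1\<close> of the Jordan blocks
  \<open>x\<^sub>1, \<dots>, x\<^sub>d\<close>, together with \<open>0\<close>.  In a block, \<open>x\<^sub>1\<close> arises from \<open>x\<^sub>d\<close> by applying \<open>N\<close>
  \<open>d - 1\<close> times, and another application gives \<open>0\<close>.\<close>

definition chain_ends :: "('b \<Rightarrow> 'b) \<Rightarrow> nat \<Rightarrow> 'b set" where
  "chain_ends N d = (N ^^ (d - 1)) ` {x. (N ^^ d) x = 0}"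

lemma linear_funpow:
  assumes "Vector_Spaces.linear (*s) (*s) N"
  shows "Vector_Spaces.linear (*s) (*s) (N ^^ k)"
proof -
  interpret Vector_Spaces.linear "(*s)" "(*s)" N by (rule assms)
  have "(N ^^ k) (x + y) = (N ^^ k) x + (N ^^ k) y" "(N ^^ k) (c *s x) = c *s (N ^^ k) x" for x y c
    by (induction k) (simp_all add: add scale)
  then show ?thesis by unfold_locales
qed

lemma funpow_jordan_chain:
  assumes "\<And>j. j \<in> {2..d} \<Longrightarrow> N (x j) = x (j - 1)" and "i < d"
  shows "(N ^^ i) (x d) = x (d - i)"
  using assms(2)
proof (induction i)
  case (Suc i)
  then have "(N ^^ Suc i) (x d) = N (x (d - i))" by simp
  also have "\<dots> = x (d - i - 1)" using Suc.prems by (intro assms(1)) auto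
  finally show ?case by simp
qed simp

text \<open>In a relation between the chains generated by vectors \<open>y k\<close>, let \<open>m\<close> be the highest
  level that occurs.  Applying \<open>N\<close> another \<open>m - 1\<close> times kills all lower levels and leaves a
  relation between the chain ends.\<close>

lemma independent_family_chains:
  fixes y :: "nat \<Rightarrow> 'b"
  assumes N: "Vector_Spaces.linear (*s) (*s) N"
    and y: "\<And>k. k < n \<Longrightarrow> (N ^^ d) (y k) = 0"
    and ind: "independent_family (\<lambda>k. (N ^^ (d - 1)) (y k)) {..<n}"
  shows "independent_family (\<lambda>(k, j). (N ^^ (d - j)) (y k)) ({..<n} \<times> {1..d})"
proof -
  have "\<forall>i\<in>{..<n} \<times> {1..d}. c i = 0"
    if c: "(\<Sum>i\<in>{..<n} \<times> {1..d}. c i *s (case i of (k, j) \<Rightarrow> (N ^^ (d - j)) (y k))) = 0" for c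
  proof (rule ccontr)
    let ?L = "{j\<in>{1..d}. \<exists>k<n. c (k, j) \<noteq> 0}"
    assume "\<not> ?thesis"
    then have "?L \<noteq> {}" by auto
    define m where "m = Max ?L"
    have "m \<in> ?L" unfolding m_def using \<open>?L \<noteq> {}\<close> by (intro Max_in) auto
    then obtain k' where m: "1 \<le> m" "m \<le> d" and k': "k' < n" "c (k', m) \<noteq> 0" by auto
    have above: "c (k, j) = 0" if "k < n" "m < j" "j \<le> d" for k j
      using that m Max_ge[of ?L j] unfolding m_def[symmetric] by force
    interpret P: Vector_Spaces.linear "(*s)" "(*s)" "N ^^ (m - 1)" by (rule linear_funpow[OF N])
    have level: "(N ^^ (m - 1)) (c (k, j) *s (N ^^ (d - j)) (y k)) =
        (if j = m then c (k, m) *s (N ^^ (d - 1)) (y k) else 0)"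
      if k: "k < n" and j: "j \<in> {1..d}" for k j
    proof -
      have *: "(N ^^ (m - 1)) (c (k, j) *s (N ^^ (d - j)) (y k)) =
          c (k, j) *s (N ^^ (m - 1 + (d - j))) (y k)"
        by (simp only: P.scale funpow_add o_apply)
      consider "j < m" | "j = m" | "j > m" by linarith
      then show ?thesis
      proof cases
        case 1
        then have "m - 1 + (d - j) = (m - 1 - j) + d" using m by simp
        then have "(N ^^ (m - 1 + (d - j))) (y k) = (N ^^ (m - 1 - j)) 0"
          using y[OF k] by (simp add: funpow_add)
        also have "\<dots> = 0"
          by (rule module_hom.zero[OF linear_funpow[OF N, folded module_hom_iff_linear]])
        finally show ?thesis using * 1 by simp
      next
        case 2
        then have "m - 1 + (d - j) = d - 1" using m by simp
        with * 2 show ?thesis by simp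
      next
        case 3
        with * above[OF k] j show ?thesis by simp
      qed
    qed
    have "0 = (N ^^ (m - 1)) (\<Sum>k<n. \<Sum>j=1..d. c (k, j) *s (N ^^ (d - j)) (y k))"
      using c P.zero by (simp add: sum.cartesian_product split_def del: One_nat_def)
    also have "\<dots> = (\<Sum>k<n. \<Sum>j=1..d. (N ^^ (m - 1)) (c (k, j) *s (N ^^ (d - j)) (y k)))"
      by (simp only: P.sum)
    also have "\<dots> = (\<Sum>k<n. \<Sum>j=1..d. if j = m then c (k, m) *s (N ^^ (d - 1)) (y k) else 0)"
      by (intro sum.cong refl level) auto
    also have "\<dots> = (\<Sum>k<n. c (k, m) *s (N ^^ (d - 1)) (y k))"
      using m by simp
    finally have "c (k', m) = 0"
      using ind k'(1) independent_family_iff[of "{..<n}"] by (metis finite_lessThan lessThan_iff)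
    with k' show False by simp
  qed
  then show ?thesis by (subst independent_family_iff) auto
qed

text \<open>Blocks are jointly independent as soon as their eigenvectors are, and every vector of
  \<^const>\<open>chain_ends\<close> can be continued upwards to a chain of length \<open>d\<close>.  So the choice of \<open>n\<close>
  blocks amounts to the choice of \<open>n\<close> independent eigenvectors.\<close>

lemma has_jordan_blocks_iff:
  assumes N: "Vector_Spaces.linear (*s) (*s) (\<lambda>x. T x - l *s x)" and d: "d \<ge> 1"
  shows "has_jordan_blocks T l d n \<longleftrightarrow>
    (\<exists>A. finite A \<and> A \<subseteq> chain_ends (\<lambda>x. T x - l *s x) d \<and> independent A \<and> card A = n)"
proof
  let ?N = "\<lambda>x. T x - l *s x"
  assume "has_jordan_blocks T l d n"
  then obtain x :: "nat \<Rightarrow> nat \<Rightarrow> 'b" where x: "\<And>k. k < n \<Longrightarrow> jordan_block T l d (x k)"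
    and ind: "independent_family (\<lambda>(k, j). x k j) ({..<n} \<times> {1..d})"
    unfolding has_jordan_blocks_def by blast
  have "independent_family (\<lambda>(k, j). x k j) ((\<lambda>k. (k, 1)) ` {..<n})"
    using d by (intro independent_family_subset[OF ind]) auto
  then have "independent_family (\<lambda>k. x k 1) {..<n}"
    by (subst (asm) independent_family_image) (auto intro: inj_onI)
  then have A: "inj_on (\<lambda>k. x k 1) {..<n}" "independent ((\<lambda>k. x k 1) ` {..<n})"
    by (auto simp: independent_family_def)
  have "x k 1 \<in> chain_ends ?N d" if "k < n" for k
  proof -
    have top: "(?N ^^ (d - 1)) (x k d) = x k 1"
      using x[OF that] d funpow_jordan_chain[of d ?N "x k" "d - 1"] by (simp add: jordan_block_def)
    have "(?N ^^ d) (x k d) = ?N ((?N ^^ (d - 1)) (x k d))"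
      using d by (cases d) simp_all
    also have "\<dots> = 0" unfolding top using x[OF that] by (simp add: jordan_block_def)
    finally show ?thesis using top unfolding chain_ends_def by (metis (mono_tags) imageI mem_Collect_eq)
  qed
  with A show "\<exists>A. finite A \<and> A \<subseteq> chain_ends ?N d \<and> independent A \<and> card A = n"
    by (intro exI[of _ "(\<lambda>k. x k 1) ` {..<n}"]) (auto simp: card_image)
next
  let ?N = "\<lambda>x. T x - l *s x"
  assume "\<exists>A. finite A \<and> A \<subseteq> chain_ends ?N d \<and> independent A \<and> card A = n"
  then obtain A where A: "finite A" "A \<subseteq> chain_ends ?N d" "independent A" "card A = n" by blast
  obtain h where h: "bij_betw h {..<n} A"
    using ex_bij_betw_nat_finite[OF A(1)] A(4) by (auto simp: atLeast0LessThan)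
  have "\<exists>y. (?N ^^ d) y = 0 \<and> (?N ^^ (d - 1)) y = h k" if "k < n" for k
  proof -
    have "h k \<in> chain_ends ?N d" using h A(2) that by (auto dest: bij_betw_apply)
    then show ?thesis by (auto simp: chain_ends_def)
  qed
  then obtain y where y: "\<And>k. k < n \<Longrightarrow> (?N ^^ d) (y k) = 0"
    and yh: "\<And>k. k < n \<Longrightarrow> (?N ^^ (d - 1)) (y k) = h k" by metis
  define x where "x k j = (?N ^^ (d - j)) (y k)" for k j
  have "independent_family (\<lambda>k. (?N ^^ (d - 1)) (y k)) {..<n}"
    using h A(3) yh unfolding independent_family_def bij_betw_def
    by (auto simp: inj_on_def image_def)
  then have ind: "independent_family (\<lambda>(k, j). x k j) ({..<n} \<times> {1..d})"
    unfolding x_def by (intro independent_family_chains[OF N y])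
  moreover have "jordan_block T l d (x k)" if k: "k < n" for k
    unfolding jordan_block_def
  proof (intro conjI ballI)
    have "independent_family (\<lambda>(k, j). x k j) (Pair k ` {1..d})"
      using k by (intro independent_family_subset[OF ind]) auto
    then show "independent_family (x k) {1..d}"
      by (subst (asm) independent_family_image) (auto intro: inj_onI)
    have step: "?N (x k j) = (?N ^^ Suc (d - j)) (y k)" for j by (simp add: x_def)
    have "?N (x k 1) = 0" unfolding step using y[OF k] d by (simp add: Suc_diff_le del: funpow.simps)
    then show "T (x k 1) = l *s x k 1" by simp
    fix j assume "j \<in> {2..d}"
    then have "Suc (d - j) = d - (j - 1)" by auto
    then have "?N (x k j) = x k (j - 1)" unfolding step by (simp only: x_def)
    then show "T (x k j) = x k (j - 1) + l *s x k j" by (simp add: algebra_simps)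
  qed
  ultimately show "has_jordan_blocks T l d n" unfolding has_jordan_blocks_def by blast
qed

lemma number_of_jordan_blocks_eq_edim:
  assumes "Vector_Spaces.linear (*s) (*s) (\<lambda>x. T x - l *s x)" and "d \<ge> 1"
  shows "number_of_jordan_blocks T l d = edim (chain_ends (\<lambda>x. T x - l *s x) d)"
  unfolding number_of_jordan_blocks_def edim_eq_SUP_independent has_jordan_blocks_iff[OF assms]
  by (rule arg_cong[where f = Sup], rule image_cong) auto

end


section \<open>Squares of antilinear maps\<close>

context complex_vector_space
begin

context
  fixes J :: "'b \<Rightarrow> 'b" and l :: real
  assumes J: "antilinear J" and l: "l < 0"
begin

interpretation linear_shift: Vector_Spaces.linear "(*s)" "(*s)" "\<lambda>x. J (J x) - complex_of_real l *s x"
  by unfold_locales (simp_all add: antilinear_simps[OF J] algebra_simps)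

text \<open>The scalar \<open>l\<close> passes through \<open>J\<close> unconjugated because it is real.\<close>

lemma antilinear_commute_shift:
  "J (J (J x) - complex_of_real l *s x) = J (J (J x)) - complex_of_real l *s J x"
  by (simp add: antilinear_simps[OF J])

lemma even_or_infinite_jordan_blocks_square:
  assumes d: "d \<ge> 1"
  shows "even_or_infinite (number_of_jordan_blocks (\<lambda>x. J (J x)) (complex_of_real l) d)"
proof -
  let ?N = "\<lambda>x. J (J x) - complex_of_real l *s x"
  have comm: "J ((?N ^^ k) x) = (?N ^^ k) (J x)" for k x
    by (induction k) (simp_all add: antilinear_simps[OF J])
  have "even_or_infinite (edim (chain_ends ?N d))"
  proof (rule even_or_infinite_edim_antilinear[OF J _ _ l])
    fix x assume "x \<in> chain_ends ?N d"
    then obtain z where z: "(?N ^^ d) z = 0" "x = (?N ^^ (d - 1)) z" by (auto simp: chain_ends_def)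
    have "(?N ^^ d) (J z) = 0" using comm[of d z] z(1) antilinear_simps(3)[OF J] by simp
    moreover have "J x = (?N ^^ (d - 1)) (J z)" using comm z(2) by simp
    ultimately show "J x \<in> chain_ends ?N d" unfolding chain_ends_def by blast
    have "?N x = (?N ^^ Suc (d - 1)) z" using z(2) by simp
    also have "\<dots> = 0" using z(1) d by simp
    finally show "J (J x) = complex_of_real l *s x" by simp
  qed
  then show ?thesis
    by (simp add: number_of_jordan_blocks_eq_edim[OF linear_shift.linear_axioms d])
qed

lemma even_or_infinite_edim_kernel_square:
  "even_or_infinite (edim (kernel (\<lambda>x. complex_of_real l *s x - J (J x))))"
  by (rule even_or_infinite_edim_antilinear[OF J _ _ l])
    (auto simp: kernel_def antilinear_simps[OF J] dest: sym)

lemma even_or_infinite_codim_range_square: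
  "even_or_infinite (codim (range (\<lambda>x. complex_of_real l *s x - J (J x))))"
proof -
  let ?N = "\<lambda>x. J (J x) - complex_of_real l *s x"
  have "complex_of_real l *s x - J (J x) = ?N (- x)" for x
    by (simp add: antilinear_simps[OF J])
  then have eq: "range (\<lambda>x. complex_of_real l *s x - J (J x)) = range ?N"
    using surj_uminus by (simp only: image_image[of ?N uminus, symmetric]) auto
  show ?thesis
    unfolding eq
  proof (rule even_or_infinite_codim_antilinear[OF J _ _ _ l])
    show "subspace (range ?N)" by (intro linear_shift.subspace_image subspace_UNIV)
    show "J x \<in> range ?N" if "x \<in> range ?N" for x
      using that antilinear_commute_shift by auto
  qed auto
qed

end

end


section \<open>Real operators\<close>

definition conjugate :: "'a::real_vector complexification \<Rightarrow> 'a complexification" where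
  "conjugate x = Cx (re_part x) (- im_part x)"

lemma conjugate_simps [simp]:
  "re_part (conjugate x) = re_part x" "im_part (conjugate x) = - im_part x"
  "conjugate (conjugate x) = x"
  by (simp_all add: conjugate_def)

lemma antilinear_comp_conjugate:
  assumes "\<And>x y. S (x + y) = S x + S y" "\<And>c x. S (c *\<^sub>C x) = c *\<^sub>C S x"
  shows "cx.antilinear (\<lambda>x. S (conjugate x))"
proof -
  have "conjugate (x + y) = conjugate x + conjugate y" for x y :: "'a complexification"
    by (rule complexification_eqI) simp_all
  moreover have "conjugate (c *\<^sub>C x) = cnj c *\<^sub>C conjugate x" for c and x :: "'a complexification"
    by (rule complexification_eqI) simp_all
  ultimately show ?thesis using assms by (simp add: cx.antilinear_def)
qed

text \<open>A complex-linear map is determined by its values on real points, and there a real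
  operator commutes with conjugation because both sides are real.\<close>

lemma real_operator_conjugate:
  assumes "real_operator S"
  shows "S (conjugate x) = conjugate (S x)"
proof -
  have add: "S (x + y) = S x + S y" and scale: "S (c *\<^sub>C x) = c *\<^sub>C S x" for x y c
    using assms by (auto simp: real_operator_def bounded_complex_linear_def
        linear_add[OF bounded_linear.linear])
  have "\<exists>y'. S (Cx y 0) = Cx y' 0" for y
    using assms unfolding real_operator_def real_points_def by blast
  then obtain f where f: "\<And>y. S (Cx y 0) = Cx (f y) 0" by metis
  have split: "z = Cx (re_part z) 0 + \<i> *\<^sub>C Cx (im_part z) 0" for z :: "'a complexification"
    by (rule complexification_eqI) simp_all
  have split': "conjugate z = Cx (re_part z) 0 + (- \<i>) *\<^sub>C Cx (im_part z) 0"
    for z :: "'a complexification"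
    by (rule complexification_eqI) simp_all
  have "S (conjugate x) = Cx (f (re_part x)) 0 + (- \<i>) *\<^sub>C Cx (f (im_part x)) 0"
    by (simp only: split'[of x] add scale f)
  also have "\<dots> = conjugate (Cx (f (re_part x)) 0 + \<i> *\<^sub>C Cx (f (im_part x)) 0)"
    by (rule complexification_eqI) simp_all
  also have "Cx (f (re_part x)) 0 + \<i> *\<^sub>C Cx (f (im_part x)) 0 = S x"
    by (subst (2) split[of x]) (simp only: add scale f)
  finally show ?thesis .
qed

lemma dual_apply_eqI:
  assumes "\<And>x. dual_apply f x = dual_apply g x"
  shows "f = g"
  using assms dual_apply_bij by (metis UNIV_I bij_betw_imp_inj_on ext inj_onD)

lemma dual_apply_simps:
  "dual_apply (f + g) x = dual_apply f x + dual_apply g x"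
  "dual_apply (c *\<^sub>C f) x = c * dual_apply f x"
  "dual_apply (conjugate f) x = cnj (dual_apply f (conjugate x))"
  by (simp_all add: dual_apply_def complex_eq_iff blinfun.add_left blinfun.diff_left
      blinfun.minus_left blinfun.minus_right blinfun.scaleR_left algebra_simps)

theorem theorem2p13:
  fixes T :: "'a::banach complexification \<Rightarrow> 'a complexification"
  assumes "real_operator T"
    and "\<exists>S. real_operator S \<and> S \<circ> S = T"
  shows "(\<forall>d::nat. \<forall>l::real. d \<ge> 1 \<and> l < 0 \<longrightarrow>
            (cx.has_jordan_block T (complex_of_real l) d \<longrightarrow>
               even_or_infinite (cx.number_of_jordan_blocks T (complex_of_real l) d)) \<and>
            (cx.has_jordan_block (dual_adjoint T) (complex_of_real l) d \<longrightarrow>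
               even_or_infinite (cx.number_of_jordan_blocks (dual_adjoint T) (complex_of_real l) d)))
       \<and> (\<forall>l::real. l < 0 \<longrightarrow>
            even_or_infinite (cx.edim (cx.kernel (\<lambda>x. complex_of_real l *\<^sub>C x - T x))) \<and>
            even_or_infinite (cx.codim (range (\<lambda>x. complex_of_real l *\<^sub>C x - T x))))"
proof -
  obtain S where S: "real_operator S" "S \<circ> S = T" using assms(2) by blast
  have bS: "bounded_complex_linear S" and bT: "bounded_complex_linear T"
    using S(1) assms(1) by (simp_all add: real_operator_def)
  \<comment> \<open>The dual space carries its own conjugation \<open>f \<mapsto> cnj \<circ> f \<circ> conjugate\<close>, with which the
    adjoint of the real operator \<open>S\<close> commutes.\<close>
  define J where "J = (\<lambda>x. S (conjugate x))"
  define J' where "J' = (\<lambda>f. dual_adjoint S (conjugate f))"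
  have J: "cx.antilinear J"
    unfolding J_def using bS
    by (intro antilinear_comp_conjugate)
      (auto simp: bounded_complex_linear_def linear_add[OF bounded_linear.linear])
  have J': "cx.antilinear J'"
    unfolding J'_def
    by (intro antilinear_comp_conjugate dual_apply_eqI)
      (simp_all add: dual_apply_adjoint[OF bS] dual_apply_simps)
  have T: "T = (\<lambda>x. J (J x))"
    using S by (auto simp: J_def real_operator_conjugate)
  have T': "dual_adjoint T = (\<lambda>f. J' (J' f))"
    unfolding J'_def using S(2)
    by (intro ext dual_apply_eqI)
      (auto simp: dual_apply_adjoint[OF bS] dual_apply_adjoint[OF bT] dual_apply_simps
        real_operator_conjugate[OF S(1)])
  show ?thesis
    unfolding T'
    unfolding T
    by (auto intro: cx.even_or_infinite_jordan_blocks_square[OF J]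
        cx.even_or_infinite_jordan_blocks_square[OF J']
        cx.even_or_infinite_edim_kernel_square[OF J] cx.even_or_infinite_codim_range_square[OF J])
qed

end
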